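(* Let $\mathcal{B}$ be a vv-RKBS of functions from a set $X$ to a Banach space $\mathcal{U}$, let $\mathcal{U}^*$ be the continuous dual of $\mathcal{U}$ and let $\langle\cdot,\cdot\rangle_{\mathcal{U}}\colon \mathcal{U}^*\times\mathcal{U}\to\mathbb{R}$ be the canonical duality pairing. For $(x,u^* )\in X\times\mathcal{U}^*$ define $\delta_{x,u^*}(f):=\langle u^*,f(x)\rangle_{\mathcal{U}}$ for $f\in\mathcal{B}$, let $\Delta:=\operatorname{span}\{\delta_{x,u^*} : (x,u^* )\in X\times\mathcal{U}^*\}$, and let $\overline{\Delta}$ be the closure of $\Delta$ under the norm of $\mathcal{B}^*$. Define the Banach space $$\mathcal{B}^\diamond:=\{g\colon \mathcal{B}\times\mathcal{U}^*\to\mathcal{U}^* \mid g(f,\widetilde u^* )=g_*(f)\,\widetilde u^* \text{ for some } g_*\in\overline{\Delta}\},\qquad \|g\|_{\mathcal{B}^\diamond}:=\|g_*\|_{\mathcal{B}^*}.$$ Then $(\mathcal{B},\mathcal{B}^\diamond)$ forms an adjoint pair of vv-RKBSs (with domains $X$ and $\Omega=\mathcal{B}\times\mathcal{U}^*$ and dual pair $(\mathcal{U},\mathcal{U}^* )$), with duality pairing $\langle g,f\rangle_{\mathcal{B}}:=g_*(f)$ and kernel $K\colon X\times(\mathcal{B}\times\mathcal{U}^* )\to \mathrm{Twin}(\mathcal{U},\mathcal{U}^* )$ given by $$K_{\mathcal{U}}(x,(f,\widetilde u^* ))u:=f(x)\langle\widetilde u^*,u\rangle_{\mathcal{U}},\qquad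 K_{\mathcal{U}^*}(x,(f,\widetilde u^* ))u^*:=\langle u^*,f(x)\rangle_{\mathcal{U}}\,\widetilde u^*,$$ $$K(x,(f,\widetilde u^* ))(u^*,u)=\langle u^*,f(x)\rangle_{\mathcal{U}}\langle\widetilde u^*,u\rangle_{\mathcal{U}}=\delta_{x,u^*}(f)\langle\widetilde u^*,u\rangle_{\mathcal{U}}.$$ Moreover, $$\|g\|_{\mathcal{B}^\diamond}=\|g_*\|_{\mathcal{B}^*}=\sup_{\|f\|_{\mathcal{B}}\le1}|g_*(f)|=\sup_{\|f\|_{\mathcal{B}}\le1}|\langle g,f\rangle_{\mathcal{B}}|\quad\text{for all } g\in\mathcal{B}^\diamond,$$ and the set $\operatorname{span}\{K_{\mathcal{U}^*}(x,\cdot)u^* \mid (x,u^* )\in X\times\mathcal{U}^*\}$, i.e. the span of the functions $(f,\widetilde u^* )\mapsto\delta_{x,u^*}(f)\,\widetilde u^*$ with $(x,u^* )\in X\times\mathcal{U}^*$, is dense in $\mathcal{B}^\diamond$.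
   Context: All vector spaces are real. vv-RKBS: a Banach space $\mathcal{B}$ of functions from a set $X$ to a Banach space $\mathcal{U}$ (with pointwise vector operations) such that for every $x\in X$ there is $C_x\ge0$ with $\|f(x)\|_{\mathcal{U}}\le C_x\|f\|_{\mathcal{B}}$ for all $f\in\mathcal{B}$. Dual pair: a dual pair of Banach spaces $(E,E^\diamond)$ consists of two Banach spaces and a bilinear map $\langle\cdot,\cdot\rangle_E\colon E^\diamond\times E\to\mathbb{R}$ (the pairing, or duality pairing) such that $\langle g,f\rangle_E=0$ for all $g\in E^\diamond$ implies $f=0$, and $\langle g,f\rangle_E=0$ for all $f\in E$ implies $g=0$. The pairing is continuous if this bilinear map is continuous. Twin operators: for a dual pair $(\mathcal{U},\mathcal{U}^\diamond)$, $\mathrm{Twin}(\mathcal{U},\mathcal{U}^\diamond)$ is the space of bounded bilinear maps $T\colon\mathcal{U}^\diamond\times\mathcal{U}\to\mathbb{R}$ for which there are linear operators $T_{\mathcal{U}}\colon\mathcal{U}\to\mathcal{U}$ and $T_{\mathcal{U}^\diamond}\colon\mathcal{U}^\diamond\to\mathcal{U}^\diamond$ with $\langle u^\diamond,T_{\mathcal{U}}u\rangle_{\mathcal{U}}=T(u^\diamond,u)=\langle T_{\mathcal{U}^\diamond}u^\diamond,u\rangle_{\mathcal{U}}$ for all $u^\diamond\in\mathcal{U}^\diamond$, $u\in\mathcal{U}$. For $K\colon X\times\Omega\to\mathrm{Twin}(\mathcal{U},\mathcal{U}^\diamond)$, $K_{\mathcal{U}}(x,w)$ and $K_{\mathcal{U}^\diamond}(x,w)$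 denote the two linear operators associated with $K(x,w)$. Adjoint pair of vv-RKBSs: given a dual pair $(\mathcal{U},\mathcal{U}^\diamond)$, let $\mathcal{B}$ be a vv-RKBS of functions $X\to\mathcal{U}$, $\mathcal{B}^\diamond$ a vv-RKBS of functions $\Omega\to\mathcal{U}^\diamond$, $\langle\cdot,\cdot\rangle_{\mathcal{B}}\colon\mathcal{B}^\diamond\times\mathcal{B}\to\mathbb{R}$ a continuous duality pairing and $K\colon X\times\Omega\to\mathrm{Twin}(\mathcal{U},\mathcal{U}^\diamond)$. Then $(\mathcal{B},\mathcal{B}^\diamond)$ is an adjoint pair of vv-RKBSs with (reproducing) kernel $K$ if (i) $K_{\mathcal{U}^\diamond}(x,\cdot)u^\diamond\in\mathcal{B}^\diamond$ and $\langle u^\diamond,f(x)\rangle_{\mathcal{U}}=\langle K_{\mathcal{U}^\diamond}(x,\cdot)u^\diamond,f\rangle_{\mathcal{B}}$ for all $x\in X$, $u^\diamond\in\mathcal{U}^\diamond$, $f\in\mathcal{B}$; and (ii) $K_{\mathcal{U}}(\cdot,w)u\in\mathcal{B}$ and $\langle g(w),u\rangle_{\mathcal{U}}=\langle g,K_{\mathcal{U}}(\cdot,w)u\rangle_{\mathcal{B}}$ for all $w\in\Omega$, $u\in\mathcal{U}$, $g\in\mathcal{B}^\diamond$. *)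

theory Defs
  imports "HOL-Analysis.Analysis" "HOL-Library.Function_Algebras"
begin

text \<open>Pointwise scalar multiplication, completing the pointwise operations of
  \<^theory>\<open>HOL-Library.Function_Algebras\<close> to a real vector space, so that \<^const>\<open>span\<close>,
  \<^const>\<open>subspace\<close> and \<^const>\<open>linear\<close> apply to function spaces.\<close>

instantiation "fun" :: (type, real_vector) real_vector
begin

definition scaleR_fun_def: "c *\<^sub>R f = (\<lambda>x. c *\<^sub>R f x)"

instance
  by standard (simp_all add: scaleR_fun_def fun_eq_iff scaleR_add_right scaleR_add_left)

end

text \<open>A function on a set \<open>S\<close> is encoded as a total function that vanishes off \<open>S\<close>.
  (The value off \<open>S\<close> has to be \<open>0\<close> and not \<^const>\<open>undefined\<close> for the pointwise operations of the
  type to be those of functions on \<open>S\<close>.)\<close>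

definition zero_ext :: "'a set \<Rightarrow> ('a \<Rightarrow> 'b::zero) \<Rightarrow> 'a \<Rightarrow> 'b" where
  "zero_ext S f = (\<lambda>x. if x \<in> S then f x else 0)"


subsection \<open>Banach spaces carried by a linear subspace of a vector space\<close>

text \<open>The norm \<open>N\<close> is only meaningful on the carrier \<open>V\<close>.\<close>

definition norm_on :: "'a::real_vector set \<Rightarrow> ('a \<Rightarrow> real) \<Rightarrow> bool" where
  "norm_on V N \<longleftrightarrow>
     (\<forall>v\<in>V. 0 \<le> N v) \<and>
     (\<forall>v\<in>V. N v = 0 \<longleftrightarrow> v = 0) \<and>
     (\<forall>c. \<forall>v\<in>V. N (c *\<^sub>R v) = \<bar>c\<bar> * N v) \<and>
     (\<forall>v\<in>V. \<forall>w\<in>V. N (v + w) \<le> N v + N w)"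

definition complete_on :: "'a::real_vector set \<Rightarrow> ('a \<Rightarrow> real) \<Rightarrow> bool" where
  "complete_on V N \<longleftrightarrow>
     (\<forall>s::nat \<Rightarrow> 'a.
        (\<forall>n. s n \<in> V) \<and> (\<forall>e>0. \<exists>M. \<forall>m\<ge>M. \<forall>n\<ge>M. N (s m - s n) < e)
        \<longrightarrow> (\<exists>l\<in>V. (\<lambda>n. N (s n - l)) \<longlonglongrightarrow> 0))"

definition banach_on :: "'a::real_vector set \<Rightarrow> ('a \<Rightarrow> real) \<Rightarrow> bool" where
  "banach_on V N \<longleftrightarrow> subspace V \<and> norm_on V N \<and> complete_on V N"

definition dense_on :: "'a::real_vector set \<Rightarrow> ('a \<Rightarrow> real) \<Rightarrow> 'a set \<Rightarrow> bool" where
  "dense_on V N S \<longleftrightarrow> S \<subseteq> V \<and> (\<forall>v\<in>V. \<forall>e>0. \<exists>s\<in>S. N (v - s) < e)"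

definition linear_functional_on :: "'a::real_vector set \<Rightarrow> ('a \<Rightarrow> real) \<Rightarrow> bool" where
  "linear_functional_on V \<phi> \<longleftrightarrow>
     (\<forall>v\<in>V. \<forall>w\<in>V. \<phi> (v + w) = \<phi> v + \<phi> w) \<and> (\<forall>c. \<forall>v\<in>V. \<phi> (c *\<^sub>R v) = c * \<phi> v)"

definition dual_on :: "'a::real_vector set \<Rightarrow> ('a \<Rightarrow> real) \<Rightarrow> ('a \<Rightarrow> real) set" where
  "dual_on V N =
     {\<phi>. linear_functional_on V \<phi> \<and> (\<exists>C. \<forall>v\<in>V. \<bar>\<phi> v\<bar> \<le> C * N v) \<and> (\<forall>v. v \<notin> V \<longrightarrow> \<phi> v = 0)}"

text \<open>The operator norm, defined like \<^const>\<open>onorm\<close>; the quotient at \<open>v = 0\<close> is \<open>0\<close>.\<close>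

definition dual_norm_on :: "'a::real_vector set \<Rightarrow> ('a \<Rightarrow> real) \<Rightarrow> ('a \<Rightarrow> real) \<Rightarrow> real" where
  "dual_norm_on V N \<phi> = (SUP v\<in>V. \<bar>\<phi> v\<bar> / N v)"

definition dual_closure_on ::
  "'a::real_vector set \<Rightarrow> ('a \<Rightarrow> real) \<Rightarrow> ('a \<Rightarrow> real) set \<Rightarrow> ('a \<Rightarrow> real) set" where
  "dual_closure_on V N D =
     {\<phi> \<in> dual_on V N. \<forall>e>0. \<exists>\<psi>\<in>D. dual_norm_on V N (\<phi> - \<psi>) < e}"


subsection \<open>Vector-valued reproducing kernel Banach spaces\<close>

definition vv_RKBS :: "'x set \<Rightarrow> ('x \<Rightarrow> 'u::banach) set \<Rightarrow> (('x \<Rightarrow> 'u) \<Rightarrow> real) \<Rightarrow> bool" where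
  "vv_RKBS X B N \<longleftrightarrow>
     banach_on B N \<and>
     (\<forall>f\<in>B. \<forall>x. x \<notin> X \<longrightarrow> f x = 0) \<and>
     (\<forall>x\<in>X. \<exists>C\<ge>0. \<forall>f\<in>B. norm (f x) \<le> C * N f)"


subsection \<open>Dual pairs\<close>

text \<open>As in the notation \<open>\<langle>g, f\<rangle>\<close>, the first argument of a pairing lies in the second space of
  the pair.\<close>

definition bilinear_on ::
  "'e::real_vector set \<Rightarrow> 'd::real_vector set \<Rightarrow> ('d \<Rightarrow> 'e \<Rightarrow> real) \<Rightarrow> bool" where
  "bilinear_on E D p \<longleftrightarrow>
     (\<forall>g\<in>D. linear_functional_on E (\<lambda>f. p g f)) \<and>
     (\<forall>f\<in>E. linear_functional_on D (\<lambda>g. p g f))"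

definition dual_pair ::
  "'e::real_vector set \<Rightarrow> ('e \<Rightarrow> real) \<Rightarrow> 'd::real_vector set \<Rightarrow> ('d \<Rightarrow> real) \<Rightarrow>
     ('d \<Rightarrow> 'e \<Rightarrow> real) \<Rightarrow> bool" where
  "dual_pair E NE D ND p \<longleftrightarrow>
     banach_on E NE \<and> banach_on D ND \<and> bilinear_on E D p \<and>
     (\<forall>f\<in>E. (\<forall>g\<in>D. p g f = 0) \<longrightarrow> f = 0) \<and>
     (\<forall>g\<in>D. (\<forall>f\<in>E. p g f = 0) \<longrightarrow> g = 0)"

definition continuous_pairing ::
  "'e::real_vector set \<Rightarrow> ('e \<Rightarrow> real) \<Rightarrow> 'd::real_vector set \<Rightarrow> ('d \<Rightarrow> real) \<Rightarrow>
     ('d \<Rightarrow> 'e \<Rightarrow> real) \<Rightarrow> bool" where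
  "continuous_pairing E NE D ND p \<longleftrightarrow>
     (\<forall>g0\<in>D. \<forall>f0\<in>E. \<forall>e>0. \<exists>d>0. \<forall>g\<in>D. \<forall>f\<in>E.
        ND (g - g0) < d \<and> NE (f - f0) < d \<longrightarrow> \<bar>p g f - p g0 f0\<bar> < e)"


subsection \<open>Twin operators\<close>

definition Twin :: "('d::real_normed_vector \<Rightarrow> 'u::real_normed_vector \<Rightarrow> real) \<Rightarrow>
    ('d \<Rightarrow> 'u \<Rightarrow> real) set" where
  "Twin p =
     {T. bounded_bilinear T \<and>
         (\<exists>TU TD. linear TU \<and> linear TD \<and>
            (\<forall>d u. p d (TU u) = T d u \<and> T d u = p (TD d) u))}"

text \<open>The two operators of a twin operator are unique since the pairing is nondegenerate.\<close>

definition twin_op :: "('d::real_normed_vector \<Rightarrow> 'u::real_normed_vector \<Rightarrow> real) \<Rightarrow>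
    ('d \<Rightarrow> 'u \<Rightarrow> real) \<Rightarrow> 'u \<Rightarrow> 'u" where
  "twin_op p T = (THE TU. linear TU \<and> (\<forall>d u. p d (TU u) = T d u))"

definition twin_op_dual :: "('d::real_normed_vector \<Rightarrow> 'u::real_normed_vector \<Rightarrow> real) \<Rightarrow>
    ('d \<Rightarrow> 'u \<Rightarrow> real) \<Rightarrow> 'd \<Rightarrow> 'd" where
  "twin_op_dual p T = (THE TD. linear TD \<and> (\<forall>d u. T d u = p (TD d) u))"


subsection \<open>Adjoint pairs of vv-RKBSs\<close>

text \<open>The functions \<open>K\<^sub>U(\<cdot>, w) u\<close> on \<open>X\<close> and \<open>K\<^sub>D(x, \<cdot>) d\<close> on \<open>W\<close>, where \<open>D\<close> is the space paired
  with \<open>U\<close>.\<close>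

definition kernel_fun ::
  "'x set \<Rightarrow> ('d::real_normed_vector \<Rightarrow> 'u::real_normed_vector \<Rightarrow> real) \<Rightarrow>
     ('x \<Rightarrow> 'w \<Rightarrow> 'd \<Rightarrow> 'u \<Rightarrow> real) \<Rightarrow> 'w \<Rightarrow> 'u \<Rightarrow> 'x \<Rightarrow> 'u" where
  "kernel_fun X p K w u = zero_ext X (\<lambda>x. twin_op p (K x w) u)"

definition kernel_fun_dual ::
  "'w set \<Rightarrow> ('d::real_normed_vector \<Rightarrow> 'u::real_normed_vector \<Rightarrow> real) \<Rightarrow>
     ('x \<Rightarrow> 'w \<Rightarrow> 'd \<Rightarrow> 'u \<Rightarrow> real) \<Rightarrow> 'x \<Rightarrow> 'd \<Rightarrow> 'w \<Rightarrow> 'd" where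
  "kernel_fun_dual W p K x d = zero_ext W (\<lambda>w. twin_op_dual p (K x w) d)"

definition adjoint_pair_vv_RKBS ::
  "'x set \<Rightarrow> ('x \<Rightarrow> 'u::banach) set \<Rightarrow> (('x \<Rightarrow> 'u) \<Rightarrow> real) \<Rightarrow>
   'w set \<Rightarrow> ('w \<Rightarrow> 'd::banach) set \<Rightarrow> (('w \<Rightarrow> 'd) \<Rightarrow> real) \<Rightarrow>
   ('d \<Rightarrow> 'u \<Rightarrow> real) \<Rightarrow> (('w \<Rightarrow> 'd) \<Rightarrow> ('x \<Rightarrow> 'u) \<Rightarrow> real) \<Rightarrow>
   ('x \<Rightarrow> 'w \<Rightarrow> 'd \<Rightarrow> 'u \<Rightarrow> real) \<Rightarrow> bool" where
  "adjoint_pair_vv_RKBS X B NB W D ND pU pB K \<longleftrightarrow>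
     dual_pair (UNIV :: 'u set) norm (UNIV :: 'd set) norm pU \<and>
     vv_RKBS X B NB \<and>
     vv_RKBS W D ND \<and>
     dual_pair B NB D ND pB \<and>
     continuous_pairing B NB D ND pB \<and>
     (\<forall>x\<in>X. \<forall>w\<in>W. K x w \<in> Twin pU) \<and>
     (\<forall>x\<in>X. \<forall>d. kernel_fun_dual W pU K x d \<in> D \<and>
        (\<forall>f\<in>B. pU d (f x) = pB (kernel_fun_dual W pU K x d) f)) \<and>
     (\<forall>w\<in>W. \<forall>u. kernel_fun X pU K w u \<in> B \<and>
        (\<forall>g\<in>D. pU (g w) u = pB g (kernel_fun X pU K w u)))"


subsection \<open>The adjoint space of a vv-RKBS\<close>

definition point_eval ::
  "('x \<Rightarrow> 'u::banach) set \<Rightarrow> 'x \<Rightarrow> ('u \<Rightarrow>\<^sub>L real) \<Rightarrow> ('x \<Rightarrow> 'u) \<Rightarrow> real" where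
  "point_eval B x u' = zero_ext B (\<lambda>f. blinfun_apply u' (f x))"

definition eval_span ::
  "'x set \<Rightarrow> ('x \<Rightarrow> 'u::banach) set \<Rightarrow> (('x \<Rightarrow> 'u) \<Rightarrow> real) set" where
  "eval_span X B = span {point_eval B x u' | x u'. x \<in> X}"

definition eval_closure :: "'x set \<Rightarrow> ('x \<Rightarrow> 'u::banach) set \<Rightarrow> (('x \<Rightarrow> 'u) \<Rightarrow> real) \<Rightarrow>
    (('x \<Rightarrow> 'u) \<Rightarrow> real) set" where
  "eval_closure X B N = dual_closure_on B N (eval_span X B)"

definition adj_dom :: "('x \<Rightarrow> 'u::banach) set \<Rightarrow> (('x \<Rightarrow> 'u) \<times> ('u \<Rightarrow>\<^sub>L real)) set" where
  "adj_dom B = B \<times> UNIV"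

definition adj_fun :: "('x \<Rightarrow> 'u::banach) set \<Rightarrow> (('x \<Rightarrow> 'u) \<Rightarrow> real) \<Rightarrow>
    ('x \<Rightarrow> 'u) \<times> ('u \<Rightarrow>\<^sub>L real) \<Rightarrow> 'u \<Rightarrow>\<^sub>L real" where
  "adj_fun B \<phi> = zero_ext (adj_dom B) (\<lambda>(f, v'). \<phi> f *\<^sub>R v')"

definition adj_space :: "'x set \<Rightarrow> ('x \<Rightarrow> 'u::banach) set \<Rightarrow> (('x \<Rightarrow> 'u) \<Rightarrow> real) \<Rightarrow>
    (('x \<Rightarrow> 'u) \<times> ('u \<Rightarrow>\<^sub>L real) \<Rightarrow> 'u \<Rightarrow>\<^sub>L real) set" where
  "adj_space X B N = {adj_fun B \<phi> | \<phi>. \<phi> \<in> eval_closure X B N}"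

text \<open>The functional \<open>g\<^sub>*\<close> determined by \<open>g\<close>.\<close>

definition adj_star :: "'x set \<Rightarrow> ('x \<Rightarrow> 'u::banach) set \<Rightarrow> (('x \<Rightarrow> 'u) \<Rightarrow> real) \<Rightarrow>
    (('x \<Rightarrow> 'u) \<times> ('u \<Rightarrow>\<^sub>L real) \<Rightarrow> 'u \<Rightarrow>\<^sub>L real) \<Rightarrow> ('x \<Rightarrow> 'u) \<Rightarrow> real" where
  "adj_star X B N g = (THE \<phi>. \<phi> \<in> eval_closure X B N \<and> g = adj_fun B \<phi>)"

definition adj_norm :: "'x set \<Rightarrow> ('x \<Rightarrow> 'u::banach) set \<Rightarrow> (('x \<Rightarrow> 'u) \<Rightarrow> real) \<Rightarrow>
    (('x \<Rightarrow> 'u) \<times> ('u \<Rightarrow>\<^sub>L real) \<Rightarrow> 'u \<Rightarrow>\<^sub>L real) \<Rightarrow> real" where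
  "adj_norm X B N g = dual_norm_on B N (adj_star X B N g)"

definition adj_pairing :: "'x set \<Rightarrow> ('x \<Rightarrow> 'u::banach) set \<Rightarrow> (('x \<Rightarrow> 'u) \<Rightarrow> real) \<Rightarrow>
    (('x \<Rightarrow> 'u) \<times> ('u \<Rightarrow>\<^sub>L real) \<Rightarrow> 'u \<Rightarrow>\<^sub>L real) \<Rightarrow> ('x \<Rightarrow> 'u) \<Rightarrow> real" where
  "adj_pairing X B N g f = adj_star X B N g f"

definition adj_kernel :: "'x \<Rightarrow> ('x \<Rightarrow> 'u::banach) \<times> ('u \<Rightarrow>\<^sub>L real) \<Rightarrow>
    ('u \<Rightarrow>\<^sub>L real) \<Rightarrow> 'u \<Rightarrow> real" where
  "adj_kernel x = (\<lambda>(f, v') u' u. blinfun_apply u' (f x) * blinfun_apply v' u)"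

end

theory Submission
  imports Defs
begin

text \<open>The map \<open>\<phi> \<mapsto> ((f, v') \<mapsto> \<phi> f v')\<close> is linear, and it is injective on the dual of \<open>\<B>\<close>: by
  Hahn--Banach the dual of \<open>\<U>\<close> is nonzero unless \<open>\<U> = 0\<close>, in which case \<open>\<B> = 0\<close>. So \<open>\<B>\<^sup>\<diamond>\<close> is an
  isometric copy of the closed span of the evaluations, a closed subspace of the Banach space
  \<open>\<B>\<^sup>*\<close>; the function belonging to \<open>\<delta>\<^sub>x\<^sub>,\<^sub>u\<^sub>'\<close> is the kernel section at \<open>(x, u')\<close>. Both the two
  reproducing identities and the density statement are then read off on the functionals. The pairing
  separates the points of \<open>\<B>\<close>, again by Hahn--Banach, because the evaluations do.

  Hahn--Banach is obtained from Zorn's lemma applied to the sublinear functionals below a given one: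
  a minimal sublinear functional is linear.\<close>

section \<open>A Hahn--Banach theorem for sublinear functionals\<close>

text \<open>Homogeneity is required only as an inequality for positive scalars, which is quicker to
  check for constructed functionals; \<open>sublinear_scale\<close> recovers equality, including
  scalar zero.\<close>

definition sublinear :: "('a::real_vector \<Rightarrow> real) \<Rightarrow> bool" where
  "sublinear p \<longleftrightarrow>
     (\<forall>x y. p (x + y) \<le> p x + p y) \<and> (\<forall>c>0. \<forall>x. p (c *\<^sub>R x) \<le> c * p x)"

lemma sublinear_add: "sublinear p \<Longrightarrow> p (x + y) \<le> p x + p y"
  by (simp add: sublinear_def)

lemma sublinear_zero:
  assumes "sublinear p"
  shows "p 0 = 0"
proof -
  have "p (c *\<^sub>R 0) \<le> c * p 0" if "c > 0" for c
    using assms that unfolding sublinear_def by blast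
  \<comment> \<open>The factor 1/2 gives \<open>p 0 \<le> 0\<close> and the factor 2 gives
    \<open>0 \<le> p 0\<close>.\<close>
  from this[of "1/2"] this[of 2] show ?thesis by simp
qed

lemma sublinear_scale:
  assumes "sublinear p" "0 \<le> c"
  shows "p (c *\<^sub>R x) = c * p x"
proof (cases "c = 0")
  case True
  then show ?thesis by (simp add: sublinear_zero[OF assms(1)])
next
  case False
  then have c: "c > 0" using assms(2) by simp
  have le: "p (d *\<^sub>R y) \<le> d * p y" if "d > 0" for d y
    using assms(1) that unfolding sublinear_def by blast
  \<comment> \<open>The reverse inequality is the defining one for the factor
    \<open>inverse c\<close> at the point \<open>c *\<^sub>R x\<close>.\<close>
  have "p x \<le> inverse c * p (c *\<^sub>R x)"
    using le[of "inverse c" "c *\<^sub>R x"] c by simp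
  then have "c * p x \<le> p (c *\<^sub>R x)"
    using c by (simp add: field_simps)
  with le[OF c, of x] show ?thesis by simp
qed

lemma sublinear_minus: "sublinear p \<Longrightarrow> - p (- x) \<le> p x"
  using sublinear_add[of p x "- x"] sublinear_zero[of p] by simp

lemma sublinear_norm: "sublinear (norm :: 'a::real_normed_vector \<Rightarrow> real)"
  by (simp add: sublinear_def norm_triangle_ineq)

text \<open>The largest sublinear functional \<open>q \<le> p\<close> with \<open>q (- x) \<le> - p x\<close>; a minimal \<open>p\<close> equals it for
  every \<open>x\<close>, which forces additivity.\<close>

definition sublinear_descent :: "('a::real_vector \<Rightarrow> real) \<Rightarrow> 'a \<Rightarrow> 'a \<Rightarrow> real" where
  "sublinear_descent p x y = (INF t\<in>{0..}. p (y + t *\<^sub>R x) - t * p x)"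

lemma sublinear_descent_lower:
  assumes "sublinear p" "0 \<le> t"
  shows "sublinear_descent p x y \<le> p (y + t *\<^sub>R x) - t * p x"
proof -
  \<comment> \<open>An infimum of reals is informative only over a set bounded below. A bound free
    of \<open>s\<close> comes from writing \<open>s *\<^sub>R x\<close> as the sum of
    \<open>y + s *\<^sub>R x\<close> and \<open>- y\<close>.\<close>
  have "- p (- y) \<le> p (y + s *\<^sub>R x) - s * p x" if "0 \<le> s" for s
    using sublinear_add[OF assms(1), of "y + s *\<^sub>R x" "- y"] sublinear_scale[OF assms(1) that, of x]
    by simp
  then have "bdd_below ((\<lambda>t. p (y + t *\<^sub>R x) - t * p x) ` {0..})"
    by (intro bdd_belowI2[where m = "- p (- y)"]) simp
  then show ?thesis
    unfolding sublinear_descent_def using assms(2) by (intro cINF_lower) auto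
qed

lemma sublinear_descent_greatest:
  assumes "\<And>t. 0 \<le> t \<Longrightarrow> m \<le> p (y + t *\<^sub>R x) - t * p x"
  shows "m \<le> sublinear_descent p x y"
  unfolding sublinear_descent_def using assms by (intro cINF_greatest) auto

lemma sublinear_descent_le: "sublinear p \<Longrightarrow> sublinear_descent p x \<le> p"
  using sublinear_descent_lower[of p 0 x] by (simp add: le_fun_def)

text \<open>For subadditivity, the parameters \<open>s\<close> at \<open>y\<close> and
  \<open>t\<close> at \<open>z\<close> combine to \<open>s + t\<close> at \<open>y + z\<close>, and
  the two infima are taken one after the other. For homogeneity the parameter \<open>t\<close> is
  rescaled to \<open>c * t\<close>.\<close>

lemma sublinear_sublinear_descent:
  assumes p: "sublinear p"
  shows "sublinear (sublinear_descent p x)"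
  unfolding sublinear_def
proof (intro conjI allI impI)
  fix y z
  let ?q = "sublinear_descent p x"
  have "?q (y + z) - (p (z + t *\<^sub>R x) - t * p x) \<le> p (y + s *\<^sub>R x) - s * p x"
    if "0 \<le> s" "0 \<le> t" for s t
    using sublinear_descent_lower[OF p, of "s + t" x "y + z"] that
      sublinear_add[OF p, of "y + s *\<^sub>R x" "z + t *\<^sub>R x"]
    by (simp add: algebra_simps)
  then have "?q (y + z) - (p (z + t *\<^sub>R x) - t * p x) \<le> ?q y" if "0 \<le> t" for t
    using that by (blast intro: sublinear_descent_greatest)
  then have "?q (y + z) - ?q y \<le> p (z + t *\<^sub>R x) - t * p x" if "0 \<le> t" for t
    using that by (simp add: algebra_simps)
  then have "?q (y + z) - ?q y \<le> ?q z"
    by (blast intro: sublinear_descent_greatest)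
  then show "?q (y + z) \<le> ?q y + ?q z" by simp
next
  fix c :: real and y
  assume c: "0 < c"
  let ?q = "sublinear_descent p x"
  have "?q (c *\<^sub>R y) / c \<le> p (y + t *\<^sub>R x) - t * p x" if "0 \<le> t" for t
  proof -
    have "?q (c *\<^sub>R y) \<le> p (c *\<^sub>R (y + t *\<^sub>R x)) - c * t * p x"
      using sublinear_descent_lower[OF p, of "c * t" x "c *\<^sub>R y"] c that
      by (simp add: algebra_simps)
    also have "\<dots> = c * (p (y + t *\<^sub>R x) - t * p x)"
      using sublinear_scale[OF p, of c "y + t *\<^sub>R x"] c
      by (simp add: right_diff_distrib mult.assoc)
    finally show ?thesis using c by (simp add: field_simps)
  qed
  then have "?q (c *\<^sub>R y) / c \<le> ?q y"
    by (blast intro: sublinear_descent_greatest)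
  then show "?q (c *\<^sub>R y) \<le> c * ?q y"
    using c by (simp add: field_simps)
qed

text \<open>Supplies the bounds of chains for Zorn's lemma. An infimum of sublinear functionals need
  not be subadditive; in a chain, functionals \<open>r\<close> and \<open>s\<close> chosen for
  \<open>y\<close> and \<open>z\<close> can both be replaced by the smaller one.\<close>

lemma sublinear_chain_Inf:
  fixes C :: "('a::real_vector \<Rightarrow> real) set"
  assumes "C \<noteq> {}"
    and sub: "\<And>r. r \<in> C \<Longrightarrow> sublinear r" and le: "\<And>r. r \<in> C \<Longrightarrow> r \<le> p"
    and chain: "\<And>r s. r \<in> C \<Longrightarrow> s \<in> C \<Longrightarrow> r \<le> s \<or> s \<le> r"
  defines "q \<equiv> \<lambda>y. INF r\<in>C. r y"
  shows "sublinear q" "r \<in> C \<Longrightarrow> q \<le> r"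
proof -
  \<comment> \<open>The infima are finite because \<open>r y \<ge> - r (- y) \<ge> - p (- y)\<close>
    uniformly in \<open>r\<close>.\<close>
  have "- p (- y) \<le> r y" if "r \<in> C" for r y
    using sublinear_minus[OF sub[OF that], of y] le[OF that]
    by (meson le_funD neg_le_iff_le order_trans)
  then have bdd: "bdd_below ((\<lambda>r. r y) ` C)" for y
    by (intro bdd_belowI2[where m = "- p (- y)"]) simp
  have lower: "q y \<le> r y" if "r \<in> C" for r y
    unfolding q_def using bdd that by (rule cINF_lower)
  then show "r \<in> C \<Longrightarrow> q \<le> r" by (simp add: le_fun_def)
  have greatest: "m \<le> q y" if "\<And>r. r \<in> C \<Longrightarrow> m \<le> r y" for m y
    unfolding q_def using assms(1) that by (rule cINF_greatest)
  show "sublinear q"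
    unfolding sublinear_def
  proof (intro conjI allI impI)
    fix y z
    have "q (y + z) \<le> r y + s z" if rs: "r \<in> C" "s \<in> C" for r s
    proof -
      obtain m where m: "m \<in> C" "m \<le> r" "m \<le> s" using chain[OF rs] rs by blast
      have "q (y + z) \<le> m y + m z"
        using lower[OF m(1)] sublinear_add[OF sub[OF m(1)]] by (meson order_trans)
      also have "\<dots> \<le> r y + s z" 
        using le_funD[OF m(2), of y] le_funD[OF m(3), of z] by simp
      finally show ?thesis .
    qed
    then have "q (y + z) - s z \<le> q y" if "s \<in> C" for s
      using that by (intro greatest) (simp add: algebra_simps)
    then have "q (y + z) - q y \<le> q z"
      by (intro greatest) (simp add: algebra_simps)
    then show "q (y + z) \<le> q y + q z" by simp
  next
    fix c :: real and y
    assume c: "0 < c"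
    have "q (c *\<^sub>R y) / c \<le> r y" if "r \<in> C" for r
      using lower[OF that, of "c *\<^sub>R y"] sublinear_scale[OF sub[OF that], of c y] c
      by (simp add: field_simps)
    then have "q (c *\<^sub>R y) / c \<le> q y" by (rule greatest)
    then show "q (c *\<^sub>R y) \<le> c * q y" using c by (simp add: field_simps)
  qed
qed

text \<open>A minimal \<open>f\<close> coincides with its descent in every direction, since the
  descent is again sublinear and below \<open>p\<close>. This makes \<open>f\<close> superadditive,
  hence additive.\<close>

theorem linear_below_sublinear:
  fixes p :: "'a::real_vector \<Rightarrow> real"
  assumes p: "sublinear p"
  shows "\<exists>f. linear f \<and> f \<le> p"
proof -
  let ?A = "{q. sublinear q \<and> q \<le> p}"
  \<comment> \<open>The order is reversed, so that the maximal element from Zorn's lemma is a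
    minimal functional.\<close>
  let ?P = "\<lambda>q r. r \<le> q"
  have "partial_order_on ?A (relation_of ?P ?A)"
    by (rule partial_order_on_relation_ofI) auto
  moreover have "\<exists>u\<in>?A. \<forall>a\<in>C. ?P a u" if C: "C \<in> Chains (relation_of ?P ?A)" for C
  proof (cases "C = {}")
    case True
    then show ?thesis using p by auto
  next
    case False
    \<comment> \<open>Comparing a chain element with itself in \<open>relation_of\<close> yields its
      membership in \<open>?A\<close>.\<close>
    have sub: "sublinear r" "r \<le> p" if "r \<in> C" for r
      using C that by (auto simp: Chains_def relation_of_def)
    have chain: "r \<le> s \<or> s \<le> r" if "r \<in> C" "s \<in> C" for r s
      using C that by (fastforce simp: Chains_def relation_of_def)
    note Inf = sublinear_chain_Inf[OF False sub chain]
    from False obtain r where r: "r \<in> C" by blast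
    have "(\<lambda>y. INF r\<in>C. r y) \<le> p"
      using Inf(2)[OF _ _ _ _ r] sub(2)[OF r] by (rule order_trans)
    then show ?thesis
      using Inf by (intro bexI[of _ "\<lambda>y. INF r\<in>C. r y"]) auto
  qed
  ultimately obtain f where f: "f \<in> ?A" and min: "\<And>a. a \<in> ?A \<Longrightarrow> a \<le> f \<Longrightarrow> a = f"
    using predicate_Zorn[of ?A ?P] by blast
  from f have sub: "sublinear f" and fp: "f \<le> p" by auto
  have "sublinear_descent f x = f" for x
    using sublinear_sublinear_descent[OF sub] sublinear_descent_le[OF sub, of x] fp
    by (intro min) (auto intro: order_trans)
  \<comment> \<open>The parameter value 1 in the infimum gives superadditivity.\<close>
  then have "f y \<le> f (y + x) - f x" for x y
    using sublinear_descent_lower[OF sub, of 1 x y] by simp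
  then have add: "f (x + y) = f x + f y" for x y
    using sublinear_add[OF sub, of x y] by (metis add_le_cancel_right diff_add_cancel
      order_antisym)
  have neg: "f (- x) = - f x" for x
    using add[of x "- x"] sublinear_zero[OF sub] by simp
  have "f (c *\<^sub>R x) = c * f x" for c x
  proof (cases "0 \<le> c")
    case True
    then show ?thesis by (rule sublinear_scale[OF sub])
  next
    case False
    then show ?thesis using sublinear_scale[OF sub, of "- c" x] neg[of "c *\<^sub>R x"] by simp
  qed
  with add have "linear f" by (intro linearI) auto
  with fp show ?thesis by blast
qed

text \<open>The linear functional is taken below the descent of the norm towards \<open>u\<close>
  rather than below the norm itself. At \<open>- u\<close>, parameter 1, the descent is at most
  \<open>- norm u\<close>, which forces \<open>f u \<ge> norm u\<close>.\<close>

lemma exists_norming_blinfun: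
  fixes u :: "'a::real_normed_vector"
  obtains f :: "'a \<Rightarrow>\<^sub>L real" where "f u = norm u"
proof -
  let ?q = "sublinear_descent norm u"
  obtain f where f: "linear f" "f \<le> ?q"
    using linear_below_sublinear[OF sublinear_sublinear_descent[OF sublinear_norm]] by blast
  have q: "?q \<le> norm" by (rule sublinear_descent_le[OF sublinear_norm])
  have le: "f y \<le> norm y" for y
    using f(2) q by (meson le_funD order_trans)
  have "\<bar>f y\<bar> \<le> norm y" for y
    using le[of y] le[of "- y"] linear_neg[OF f(1), of y] by simp
  then have bl: "bounded_linear f"
    using f(1) by (intro bounded_linear_intro[where K = 1]) (auto simp: linear_add linear_scale)
  have "f (- u) \<le> - norm u"
    using le_funD[OF f(2), of "- u"] sublinear_descent_lower[OF sublinear_norm, of 1 u "- u"] by simp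
  then have "f u = norm u"
    using le[of u] linear_neg[OF f(1), of u] by simp
  then show ?thesis
    using that[of "Blinfun f"] by (simp add: bounded_linear_Blinfun_apply[OF bl])
qed

lemma blinfun_separates_points:
  fixes u v :: "'a::real_normed_vector"
  assumes "\<And>f :: 'a \<Rightarrow>\<^sub>L real. f u = f v"
  shows "u = v"
proof -
  obtain f :: "'a \<Rightarrow>\<^sub>L real" where "f (u - v) = norm (u - v)"
    by (rule exists_norming_blinfun)
  with assms[of f] show ?thesis by (simp add: blinfun.diff_right)
qed


section \<open>Banach spaces carried by a linear subspace\<close>

locale normed_on =
  fixes V :: "'a::real_vector set" and N :: "'a \<Rightarrow> real"
  assumes carrier: "subspace V" and norm_on: "norm_on V N"
begin

lemma nonneg: "v \<in> V \<Longrightarrow> 0 \<le> N v"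
  using norm_on by (simp add: norm_on_def)

lemma eq_zero: "v \<in> V \<Longrightarrow> N v = 0 \<longleftrightarrow> v = 0"
  using norm_on by (simp add: norm_on_def)

lemma scale: "v \<in> V \<Longrightarrow> N (c *\<^sub>R v) = \<bar>c\<bar> * N v"
  using norm_on by (simp add: norm_on_def)

lemma triangle: "v \<in> V \<Longrightarrow> w \<in> V \<Longrightarrow> N (v + w) \<le> N v + N w"
  using norm_on by (simp add: norm_on_def)

lemma zero: "N 0 = 0"
  using eq_zero[of 0] carrier by (simp add: subspace_0)

lemma minus_commute: "v \<in> V \<Longrightarrow> w \<in> V \<Longrightarrow> N (v - w) = N (w - v)"
  using scale[of "v - w" "-1"] carrier by (simp add: subspace_diff)

lemma triangle_diff: "u \<in> V \<Longrightarrow> v \<in> V \<Longrightarrow> w \<in> V \<Longrightarrow> N (u - w) \<le> N (u - v) + N (v - w)"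
  using triangle[of "u - v" "v - w"] carrier by (simp add: subspace_diff)

end

lemma banach_on_imp_normed_on: "banach_on V N \<Longrightarrow> normed_on V N"
  by (simp add: banach_on_def normed_on_def)

lemma banach_on_UNIV: "banach_on (UNIV :: 'a::banach set) norm"
proof -
  have "\<exists>l. (\<lambda>n. norm (s n - l)) \<longlonglongrightarrow> 0"
    if "\<forall>e>0. \<exists>M. \<forall>m\<ge>M. \<forall>n\<ge>M. norm (s m - s n) < e" for s :: "nat \<Rightarrow> 'a"
  proof -
    have "Cauchy s" using that by (simp add: Cauchy_def dist_norm)
    then obtain l where "s \<longlonglongrightarrow> l" by (auto simp: Cauchy_convergent_iff convergent_def)
    then show ?thesis by (auto simp: tendsto_norm_zero_iff LIM_zero_iff)
  qed
  then show ?thesis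
    by (simp add: banach_on_def norm_on_def complete_on_def norm_triangle_ineq)
qed

text \<open>Transports the Banach structure of the closed span of evaluations to the function space,
  with \<open>adj_fun\<close> as the isometry.\<close>

lemma banach_on_linear_image:
  assumes V: "banach_on V M" and T: "linear T" and iso: "\<And>v. v \<in> V \<Longrightarrow> M' (T v) = M v"
  shows "banach_on (T ` V) M'"
  unfolding banach_on_def
proof (intro conjI)
  interpret normed_on V M using V by (rule banach_on_imp_normed_on)
  show "subspace (T ` V)"
    using T carrier by (rule linear_subspace_image)
  \<comment> \<open>Injectivity at zero follows from the isometry alone:
    \<open>M' 0 = M 0 = 0\<close>.\<close>
  have T0: "T v = 0 \<longleftrightarrow> v = 0" if "v \<in> V" for v
    using iso[OF that] iso[of 0] zero eq_zero[OF that] carrier linear_0[OF T]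
    by (auto simp: subspace_0)
  show "norm_on (T ` V) M'"
    unfolding norm_on_def using carrier
    by (auto simp: iso nonneg eq_zero T0 scale triangle subspace_scale subspace_add
        linear_add[OF T, symmetric] linear_scale[OF T, symmetric])
  show "complete_on (T ` V) M'"
    unfolding complete_on_def
  proof (intro allI impI, elim conjE)
    fix s :: "nat \<Rightarrow> 'b"
    assume "\<forall>n. s n \<in> T ` V"
    then have "\<exists>t. \<forall>n. t n \<in> V \<and> s n = T (t n)" by (intro choice) blast
    then obtain t where t: "\<And>n. t n \<in> V" "\<And>n. s n = T (t n)" by blast
    have eq: "M' (T v - T w) = M (v - w)" if "v \<in> V" "w \<in> V" for v w
      using iso[of "v - w"] that carrier by (simp add: subspace_diff linear_diff[OF T])
    assume "\<forall>e>0. \<exists>K. \<forall>m\<ge>K. \<forall>n\<ge>K. M' (s m - s n) < e"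
    then have "\<forall>e>0. \<exists>K. \<forall>m\<ge>K. \<forall>n\<ge>K. M (t m - t n) < e"
      by (simp add: t eq)
    then obtain l where "l \<in> V" "(\<lambda>n. M (t n - l)) \<longlonglongrightarrow> 0"
      using V t(1) unfolding banach_on_def complete_on_def by blast
    then show "\<exists>l\<in>T ` V. (\<lambda>n. M' (s n - l)) \<longlonglongrightarrow> 0"
      by (auto simp: t eq)
  qed
qed

text \<open>With the dual space and its norm for \<open>V\<close> and \<open>M\<close>, the set
  \<open>E\<close> is \<open>dual_closure_on\<close>. It is complete because limits exist in
  \<open>V\<close> and a limit of points approximable from \<open>D\<close> is itself
  approximable.\<close>

lemma
  assumes V: "banach_on V M" and D: "subspace D" "D \<subseteq> V"
  defines "E \<equiv> {v \<in> V. \<forall>e>0. \<exists>d\<in>D. M (v - d) < e}"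
  shows banach_on_closure: "banach_on E M" and dense_on_closure: "dense_on E M D"
proof -
  interpret normed_on V M using V by (rule banach_on_imp_normed_on)
  have DE: "D \<subseteq> E"
    using D zero by (force simp: E_def)
  then show "dense_on E M D"
    by (auto simp: dense_on_def E_def)
  have "subspace E"
  proof (rule subspaceI)
    show "0 \<in> E" using DE D by (auto simp: subspace_0)
  next
    fix v w
    assume vw: "v \<in> E" "w \<in> E"
    show "v + w \<in> E"
      unfolding E_def
    proof (intro CollectI conjI allI impI)
      show "v + w \<in> V" using vw carrier by (simp add: E_def subspace_add)
      fix e :: real
      assume "0 < e"
      then have "0 < e / 2" by simp
      then obtain a b where ab: "a \<in> D" "b \<in> D" "M (v - a) < e / 2" "M (w - b) < e / 2"
        using vw unfolding E_def by blast
      have "M ((v + w) - (a + b)) = M ((v - a) + (w - b))" by (simp add: algebra_simps)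
      also have "\<dots> \<le> M (v - a) + M (w - b)"
        using vw ab D carrier by (intro triangle) (auto simp: E_def intro: subspace_diff)
      finally have "M ((v + w) - (a + b)) < e" using ab by simp
      then show "\<exists>d\<in>D. M ((v + w) - d) < e" using ab D by (blast intro: subspace_add)
    qed
  next
    fix c v
    assume v: "v \<in> E"
    show "c *\<^sub>R v \<in> E"
      unfolding E_def
    proof (intro CollectI conjI allI impI)
      show "c *\<^sub>R v \<in> V" using v carrier by (simp add: E_def subspace_scale)
      fix e :: real
      assume e: "0 < e"
      \<comment> \<open>The summand 1 keeps the denominator positive when
        \<open>c = 0\<close>.\<close>
      then have "0 < e / (\<bar>c\<bar> + 1)" by simp
      then obtain a where a: "a \<in> D" "M (v - a) < e / (\<bar>c\<bar> + 1)"
        using v unfolding E_def by blast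
      have va: "v - a \<in> V" using v a D carrier by (auto simp: E_def intro: subspace_diff)
      have "M (c *\<^sub>R v - c *\<^sub>R a) = \<bar>c\<bar> * M (v - a)"
        using scale[OF va, of c] by (simp add: scaleR_diff_right)
      also have "\<dots> \<le> (\<bar>c\<bar> + 1) * M (v - a)"
        using nonneg[OF va] by (simp add: algebra_simps)
      also have "\<dots> < e" using a(2) by (simp add: field_simps)
      finally show "\<exists>d\<in>D. M (c *\<^sub>R v - d) < e" using a D by (blast intro: subspace_scale)
    qed
  qed
  moreover have "norm_on E M"
    using norm_on by (auto simp: norm_on_def E_def)
  moreover have "complete_on E M"
    unfolding complete_on_def
  proof (intro allI impI, elim conjE)
    fix s :: "nat \<Rightarrow> 'a"
    assume s: "\<forall>n. s n \<in> E" and "\<forall>e>0. \<exists>K. \<forall>m\<ge>K. \<forall>n\<ge>K. M (s m - s n) < e"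
    then obtain l where l: "l \<in> V" "(\<lambda>n. M (s n - l)) \<longlonglongrightarrow> 0"
      using V unfolding banach_on_def complete_on_def E_def by blast
    have "\<exists>d\<in>D. M (l - d) < e" if "0 < e" for e
    proof -
      have e: "0 < e / 2" using that by simp
      then have "eventually (\<lambda>n. M (s n - l) < e / 2) sequentially"
        using l(2) by (rule order_tendstoD(2)[rotated])
      then obtain n where n: "M (s n - l) < e / 2" by (auto simp: eventually_sequentially)
      \<comment> \<open>Half of \<open>e\<close> is spent between \<open>l\<close> and
        \<open>s n\<close>, the other half between \<open>s n\<close> and \<open>D\<close>.\<close>
      obtain d where d: "d \<in> D" "M (s n - d) < e / 2"
        using s e unfolding E_def by blast
      have "s n \<in> V" using s by (simp add: E_def)
      then have "M (l - d) < e"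
        using triangle_diff[of l "s n" d] minus_commute[of l "s n"] l(1) n d D by auto
      with d show ?thesis by blast
    qed
    then show "\<exists>l\<in>E. (\<lambda>n. M (s n - l)) \<longlonglongrightarrow> 0"
      using l by (auto simp: E_def)
  qed
  ultimately show "banach_on E M" by (simp add: banach_on_def)
qed

section \<open>The continuous dual\<close>

lemma linear_functional_on_scaled_arg:
  "linear_functional_on V \<phi> \<Longrightarrow> v \<in> V \<Longrightarrow> \<phi> (c *\<^sub>R v) = c * \<phi> v"
  by (simp add: linear_functional_on_def)

context normed_on
begin

text \<open>The functional is linear on the carrier only, so the difference is expressed by the
  scalar -1, staying inside \<open>V\<close>.\<close>

lemma functional_diff:
  assumes "linear_functional_on V \<phi>" "v \<in> V" "w \<in> V"
  shows "\<phi> (v - w) = \<phi> v - \<phi> w"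
proof -
  have "\<phi> (v + (-1) *\<^sub>R w) = \<phi> v + \<phi> ((-1) *\<^sub>R w)"
    using assms carrier by (metis linear_functional_on_def subspace_scale)
  moreover have "\<phi> ((-1) *\<^sub>R w) = - \<phi> w"
    using linear_functional_on_scaled_arg[OF assms(1,3), of "-1"] by simp
  ultimately show ?thesis by simp
qed

lemma dual_onI:
  assumes "linear_functional_on V \<phi>" "\<And>v. v \<in> V \<Longrightarrow> \<bar>\<phi> v\<bar> \<le> C * N v"
    "\<And>v. v \<notin> V \<Longrightarrow> \<phi> v = 0"
  shows "\<phi> \<in> dual_on V N"
  using assms by (auto simp: dual_on_def)

lemma dual_linear: "\<phi> \<in> dual_on V N \<Longrightarrow> linear_functional_on V \<phi>"
  by (simp add: dual_on_def)

lemma dual_outside: "\<phi> \<in> dual_on V N \<Longrightarrow> v \<notin> V \<Longrightarrow> \<phi> v = 0"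
  by (simp add: dual_on_def)

lemma dual_zero: "\<phi> \<in> dual_on V N \<Longrightarrow> \<phi> 0 = 0"
  using functional_diff[OF dual_linear, of \<phi> 0 0] carrier by (simp add: subspace_0)

section \<open>The operator norm and its estimates\<close>

lemma dual_quotient_bdd_above:
  assumes "\<phi> \<in> dual_on V N"
  shows "bdd_above ((\<lambda>v. \<bar>\<phi> v\<bar> / N v) ` V)"
proof -
  obtain C where C: "\<And>v. v \<in> V \<Longrightarrow> \<bar>\<phi> v\<bar> \<le> C * N v"
    using assms by (auto simp: dual_on_def)
  \<comment> \<open>The constant in \<open>dual_on\<close> carries no sign, hence the absolute
    value. Where \<open>N v = 0\<close> the quotient is 0 by convention.\<close>
  have "\<bar>\<phi> v\<bar> / N v \<le> \<bar>C\<bar>" if "v \<in> V" for v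
  proof (cases "N v = 0")
    case False
    then have "0 < N v" using nonneg[OF that] by simp
    moreover have "C * N v \<le> \<bar>C\<bar> * N v" using nonneg[OF that] by (simp add: mult_right_mono)
    ultimately have "0 < N v" "\<bar>\<phi> v\<bar> \<le> \<bar>C\<bar> * N v" using C[OF that] by linarith+
    then show ?thesis by (simp add: divide_le_eq)
  qed simp
  then show ?thesis by (intro bdd_aboveI2)
qed

lemma dual_norm_bound:
  assumes "\<phi> \<in> dual_on V N" "v \<in> V"
  shows "\<bar>\<phi> v\<bar> \<le> dual_norm_on V N \<phi> * N v"
proof (cases "v = 0")
  case True
  then show ?thesis using dual_zero[OF assms(1)] zero by simp
next
  case False
  then have "0 < N v" using nonneg eq_zero assms(2) by (metis less_eq_real_def)
  moreover have "\<bar>\<phi> v\<bar> / N v \<le> dual_norm_on V N \<phi>"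
    unfolding dual_norm_on_def
    using dual_quotient_bdd_above[OF assms(1)] assms(2) by (intro cSUP_upper)
  ultimately show ?thesis by (simp add: divide_le_eq)
qed

lemma dual_norm_least:
  assumes "\<And>v. v \<in> V \<Longrightarrow> \<bar>\<phi> v\<bar> \<le> C * N v" "0 \<le> C"
  shows "dual_norm_on V N \<phi> \<le> C"
proof -
  have "\<bar>\<phi> v\<bar> / N v \<le> C" if "v \<in> V" for v
    using assms nonneg[OF that] that by (cases "N v = 0") (auto simp: divide_le_eq)
  then show ?thesis
    unfolding dual_norm_on_def using carrier subspace_0 by (intro cSUP_least) auto
qed

lemma dual_norm_nonneg:
  assumes "\<phi> \<in> dual_on V N"
  shows "0 \<le> dual_norm_on V N \<phi>"
proof -
  \<comment> \<open>The quotient at the zero vector equals 0, so 0 is among the values of the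
    supremum.\<close>
  have "\<bar>\<phi> 0\<bar> / N 0 \<le> dual_norm_on V N \<phi>"
    unfolding dual_norm_on_def
    using dual_quotient_bdd_above[OF assms] carrier by (intro cSUP_upper subspace_0)
  then show ?thesis by (simp add: zero)
qed

text \<open>Links the supremum of quotients to the unit-ball formula for the norm of the adjoint
  space; a nonzero \<open>v\<close> is rescaled to norm 1.\<close>

lemma dual_norm_unit_ball:
  assumes "\<phi> \<in> dual_on V N"
  shows "dual_norm_on V N \<phi> = (SUP v\<in>{v\<in>V. N v \<le> 1}. \<bar>\<phi> v\<bar>)"
proof (rule antisym)
  have le: "\<bar>\<phi> v\<bar> \<le> dual_norm_on V N \<phi>" if "v \<in> V" "N v \<le> 1" for v
    using dual_norm_bound[OF assms that(1)] dual_norm_nonneg[OF assms] that(2) nonneg[OF that(1)]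
      mult_left_le[of "N v" "dual_norm_on V N \<phi>"] by linarith
  then have bdd: "bdd_above ((\<lambda>v. \<bar>\<phi> v\<bar>) ` {v\<in>V. N v \<le> 1})"
    by (intro bdd_aboveI2) auto
  let ?s = "SUP v\<in>{v\<in>V. N v \<le> 1}. \<bar>\<phi> v\<bar>"
  have upper: "\<bar>\<phi> v\<bar> \<le> ?s" if "v \<in> V" "N v \<le> 1" for v
    using that bdd by (intro cSUP_upper) auto
  have s0: "0 \<le> ?s"
    using upper[of 0] carrier zero by (simp add: subspace_0)
  show "dual_norm_on V N \<phi> \<le> ?s"
  proof (rule dual_norm_least)
    fix v
    assume v: "v \<in> V"
    show "\<bar>\<phi> v\<bar> \<le> ?s * N v"
    proof (cases "v = 0")
      case True
      then show ?thesis using dual_zero[OF assms] zero by simp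
    next
      case False
      then have pos: "0 < N v" using nonneg eq_zero v by (metis less_eq_real_def)
      have "\<bar>\<phi> (inverse (N v) *\<^sub>R v)\<bar> \<le> ?s"
        using v pos scale[OF v, of "inverse (N v)"] carrier
        by (intro upper) (auto simp: subspace_scale)
      then show ?thesis
        using pos linear_functional_on_scaled_arg[OF dual_linear[OF assms] v, of "inverse (N v)"]
        by (simp add: abs_mult inverse_eq_divide divide_le_eq)
    qed
  qed (rule s0)
  have "{v\<in>V. N v \<le> 1} \<noteq> {}"
    using subspace_0[OF carrier] zero by (auto intro!: exI[of _ 0])
  then show "?s \<le> dual_norm_on V N \<phi>"
    using le by (intro cSUP_least) auto
qed

section \<open>The dual as a Banach space\<close>

lemma subspace_dual: "subspace (dual_on V N)"
proof (rule subspaceI)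
  show "0 \<in> dual_on V N"
    by (rule dual_onI[where C = 0]) (auto simp: linear_functional_on_def)
next
  fix \<phi> \<psi>
  assume *: "\<phi> \<in> dual_on V N" "\<psi> \<in> dual_on V N"
  show "\<phi> + \<psi> \<in> dual_on V N"
  proof (rule dual_onI[where C = "dual_norm_on V N \<phi> + dual_norm_on V N \<psi>"])
    show "linear_functional_on V (\<phi> + \<psi>)"
      using *[THEN dual_linear] by (simp add: linear_functional_on_def algebra_simps)
    show "\<bar>(\<phi> + \<psi>) v\<bar> \<le> (dual_norm_on V N \<phi> + dual_norm_on V N \<psi>) * N v" if "v \<in> V" for v
      using *[THEN dual_norm_bound, OF that] by (simp add: distrib_right)
  qed (use * in \<open>simp add: dual_outside\<close>)
next
  fix c \<phi>
  assume *: "\<phi> \<in> dual_on V N"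
  show "c *\<^sub>R \<phi> \<in> dual_on V N"
  proof (rule dual_onI[where C = "\<bar>c\<bar> * dual_norm_on V N \<phi>"])
    show "linear_functional_on V (c *\<^sub>R \<phi>)"
      using *[THEN dual_linear]
      by (simp add: linear_functional_on_def scaleR_fun_def algebra_simps)
    show "\<bar>(c *\<^sub>R \<phi>) v\<bar> \<le> \<bar>c\<bar> * dual_norm_on V N \<phi> * N v" if "v \<in> V" for v
      using *[THEN dual_norm_bound, OF that]
      by (simp add: scaleR_fun_def abs_mult mult.assoc mult_left_mono)
  qed (use * in \<open>simp add: dual_outside scaleR_fun_def\<close>)
qed

lemma norm_on_dual: "norm_on (dual_on V N) (dual_norm_on V N)"
  unfolding norm_on_def
proof (intro conjI ballI allI)
  fix \<phi>
  assume \<phi>: "\<phi> \<in> dual_on V N"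
  show "0 \<le> dual_norm_on V N \<phi>" using \<phi> by (rule dual_norm_nonneg)
  have "\<phi> v = 0" if "dual_norm_on V N \<phi> = 0" for v
    using dual_norm_bound[OF \<phi>, of v] dual_outside[OF \<phi>, of v] that by (cases "v \<in> V") auto
  moreover have "dual_norm_on V N 0 \<le> 0" by (rule dual_norm_least) auto
  ultimately show "dual_norm_on V N \<phi> = 0 \<longleftrightarrow> \<phi> = 0"
    using dual_norm_nonneg[OF subspace_0[OF subspace_dual]] by (auto intro!: ext)
next
  fix c \<phi>
  \<comment> \<open>Stated for all scalars and functionals because the reverse inequality reuses it
    with \<open>inverse c\<close> at the scaled functional.\<close>
  have le: "dual_norm_on V N (c *\<^sub>R \<psi>) \<le> \<bar>c\<bar> * dual_norm_on V N \<psi>"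
    if "\<psi> \<in> dual_on V N" for c \<psi>
    using dual_norm_bound[OF that] dual_norm_nonneg[OF that]
    by (intro dual_norm_least) (auto simp: scaleR_fun_def abs_mult mult.assoc mult_left_mono)
  assume \<phi>: "\<phi> \<in> dual_on V N"
  show "dual_norm_on V N (c *\<^sub>R \<phi>) = \<bar>c\<bar> * dual_norm_on V N \<phi>"
  proof (cases "c = 0")
    case True
    then show ?thesis
      using le[OF \<phi>, of 0] dual_norm_nonneg[OF subspace_0[OF subspace_dual]] by simp
  next
    case False
    then have "\<bar>c\<bar> * dual_norm_on V N \<phi> \<le> dual_norm_on V N (c *\<^sub>R \<phi>)"
      using le[OF subspace_scale[OF subspace_dual \<phi>], of "inverse c" c]
      by (simp add: field_simps)
    with le[OF \<phi>, of c] show ?thesis by simp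
  qed
next
  fix \<phi> \<psi>
  assume *: "\<phi> \<in> dual_on V N" "\<psi> \<in> dual_on V N"
  have "\<bar>(\<phi> + \<psi>) v\<bar> \<le> (dual_norm_on V N \<phi> + dual_norm_on V N \<psi>) * N v" if "v \<in> V" for v
    using *[THEN dual_norm_bound, OF that] by (simp add: distrib_right)
  then show "dual_norm_on V N (\<phi> + \<psi>) \<le> dual_norm_on V N \<phi> + dual_norm_on V N \<psi>"
    using *[THEN dual_norm_nonneg] by (intro dual_norm_least) auto
qed

text \<open>The limit is taken pointwise in the reals. Estimates of the form \<open>e * N v\<close>,
  uniform over \<open>V\<close>, survive it and give both boundedness of the limit and convergence
  in norm.\<close>

lemma complete_on_dual: "complete_on (dual_on V N) (dual_norm_on V N)"
  unfolding complete_on_def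
proof (intro allI impI, elim conjE)
  let ?M = "dual_norm_on V N"
  fix s :: "nat \<Rightarrow> 'a \<Rightarrow> real"
  assume "\<forall>n. s n \<in> dual_on V N"
  then have s: "s n \<in> dual_on V N" for n by simp
  assume cauchy: "\<forall>e>0. \<exists>K. \<forall>m\<ge>K. \<forall>n\<ge>K. ?M (s m - s n) < e"
  have unif: "\<exists>K. \<forall>m\<ge>K. \<forall>n\<ge>K. \<forall>v\<in>V. \<bar>s m v - s n v\<bar> \<le> e * N v" if "0 < e" for e
  proof -
    obtain K where K: "\<And>m n. K \<le> m \<Longrightarrow> K \<le> n \<Longrightarrow> ?M (s m - s n) < e"
      using cauchy \<open>0 < e\<close> by blast
    have "\<bar>s m v - s n v\<bar> \<le> e * N v" if "K \<le> m" "K \<le> n" "v \<in> V" for m n v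
    proof -
      have "\<bar>s m v - s n v\<bar> \<le> ?M (s m - s n) * N v"
        using dual_norm_bound[OF subspace_diff[OF subspace_dual s s] that(3), of m n] by simp
      also have "\<dots> \<le> e * N v"
        using K[OF that(1,2)] nonneg[OF that(3)] by (simp add: mult_right_mono)
      finally show ?thesis .
    qed
    then show ?thesis by blast
  qed
  have "convergent (\<lambda>n. s n v)" for v
  proof (cases "v \<in> V")
    case True
    have "Cauchy (\<lambda>n. s n v)"
    proof (rule CauchyI)
      fix e :: real
      assume e: "0 < e"
      have pos: "0 < N v + 1" using nonneg[OF True] by simp
      then have "0 < e / (N v + 1)" using e by simp
      \<comment> \<open>Dividing by \<open>N v + 1\<close> also covers \<open>N v = 0\<close> and
        makes the final bound strict.\<close>
      then obtain K where K: "\<And>m n. K \<le> m \<Longrightarrow> K \<le> n \<Longrightarrow> \<bar>s m v - s n v\<bar> \<le> e / (N v + 1) * N v"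
        using unif True by blast
      have "e / (N v + 1) * N v < e"
        using e pos by (simp add: field_simps)
      then show "\<exists>K. \<forall>m\<ge>K. \<forall>n\<ge>K. norm (s m v - s n v) < e"
        using K by (metis order_le_less_trans real_norm_def)
    qed
    then show ?thesis by (simp add: Cauchy_convergent_iff)
  qed (simp add: dual_outside[OF s] convergent_const)
  then have "\<exists>l. \<forall>v. (\<lambda>n. s n v) \<longlonglongrightarrow> l v"
    unfolding convergent_def by (intro choice) blast
  then obtain l where l: "\<And>v. (\<lambda>n. s n v) \<longlonglongrightarrow> l v" by blast
  have lin: "linear_functional_on V l"
    unfolding linear_functional_on_def
  proof (intro conjI ballI allI)
    fix v w
    assume "v \<in> V" "w \<in> V"
    then have "s n (v + w) = s n v + s n w" for n
      using dual_linear[OF s] by (simp add: linear_functional_on_def)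
    then show "l (v + w) = l v + l w"
      using LIMSEQ_unique[OF l[of "v + w"]] tendsto_add[OF l[of v] l[of w]] by simp
  next
    fix c v
    assume "v \<in> V"
    then have "s n (c *\<^sub>R v) = c * s n v" for n
      using dual_linear[OF s] by (simp add: linear_functional_on_def)
    then show "l (c *\<^sub>R v) = c * l v"
      using LIMSEQ_unique[OF l[of "c *\<^sub>R v"]] tendsto_mult_left[OF l[of v], of c] by simp
  qed
  have lim: "\<exists>K. \<forall>n\<ge>K. \<forall>v\<in>V. \<bar>s n v - l v\<bar> \<le> e * N v" if "0 < e" for e
  proof -
    obtain K where K: "\<And>m n v. K \<le> m \<Longrightarrow> K \<le> n \<Longrightarrow> v \<in> V \<Longrightarrow> \<bar>s n v - s m v\<bar> \<le> e * N v"
      using unif \<open>0 < e\<close> by blast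
    \<comment> \<open>The index \<open>m\<close> tends to infinity with \<open>n\<close> and
      \<open>v\<close> fixed; \<open>K\<close> does not depend on \<open>v\<close>.\<close>
    have "\<bar>s n v - l v\<bar> \<le> e * N v" if "K \<le> n" "v \<in> V" for n v
    proof (rule Lim_bounded)
      show "(\<lambda>m. \<bar>s n v - s m v\<bar>) \<longlonglongrightarrow> \<bar>s n v - l v\<bar>"
        by (intro tendsto_intros l)
      show "\<forall>m\<ge>K. \<bar>s n v - s m v\<bar> \<le> e * N v" using K that by blast
    qed
    then show ?thesis by blast
  qed
  have "l \<in> dual_on V N"
  proof -
    obtain K where K: "\<And>v. v \<in> V \<Longrightarrow> \<bar>s K v - l v\<bar> \<le> 1 * N v" using lim[of 1] by auto
    show ?thesis
    proof (rule dual_onI[where C = "1 + ?M (s K)", OF lin])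
      fix v
      assume "v \<in> V"
      then show "\<bar>l v\<bar> \<le> (1 + ?M (s K)) * N v"
        using K[of v] dual_norm_bound[OF s, of v K] by (simp add: distrib_right)
    next
      fix v
      assume "v \<notin> V"
      then show "l v = 0" using l[of v] dual_outside[OF s] by (simp add: LIMSEQ_const_iff)
    qed
  qed
  moreover have "(\<lambda>n. ?M (s n - l)) \<longlonglongrightarrow> 0"
  proof (rule LIMSEQ_I)
    fix e :: real
    assume e: "0 < e"
    \<comment> \<open>Bounding the supremum gives a weak inequality only, so half of
      \<open>e\<close> is used to end strictly below \<open>e\<close>.\<close>
    then have "0 < e / 2" by simp
    then obtain K where K: "\<And>n v. K \<le> n \<Longrightarrow> v \<in> V \<Longrightarrow> \<bar>s n v - l v\<bar> \<le> e / 2 * N v"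
      using lim by blast
    have "?M (s n - l) \<le> e / 2" if "K \<le> n" for n
      using K[OF that] e by (intro dual_norm_least) auto
    moreover have "0 \<le> ?M (s n - l)" for n
      using \<open>l \<in> dual_on V N\<close> by (intro dual_norm_nonneg subspace_diff[OF subspace_dual] s)
    ultimately show "\<exists>K. \<forall>n\<ge>K. norm (?M (s n - l) - 0) < e"
      using e by (intro exI[of _ K]) (fastforce simp: abs_of_nonneg)
  qed
  ultimately show "\<exists>l\<in>dual_on V N. (\<lambda>n. ?M (s n - l)) \<longlonglongrightarrow> 0" by blast
qed

lemma banach_on_dual: "banach_on (dual_on V N) (dual_norm_on V N)"
  by (simp add: banach_on_def subspace_dual norm_on_dual complete_on_dual)

text \<open>The increment splits into \<open>(\<phi> - \<phi>0) v\<close> and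
  \<open>\<phi>0 (v - v0)\<close>, each controlled by the operator norm.\<close>

lemma continuous_pairing_dual:
  assumes "D \<subseteq> dual_on V N"
  shows "continuous_pairing V N D (dual_norm_on V N) (\<lambda>\<phi> v. \<phi> v)"
  unfolding continuous_pairing_def
proof (intro ballI allI impI)
  let ?M = "dual_norm_on V N"
  fix \<phi>0 v0 and e :: real
  assume \<phi>0: "\<phi>0 \<in> D" and v0: "v0 \<in> V" and e: "0 < e"
  \<comment> \<open>Since \<open>d \<le> 1\<close> gives \<open>N v < N v0 + 1\<close>, the two
    parts of the increment add up to at most \<open>c * d\<close>.\<close>
  define c where "c = N v0 + 1 + ?M \<phi>0"
  have c: "0 < c"
    using nonneg[OF v0] dual_norm_nonneg[of \<phi>0] \<phi>0 assms by (auto simp: c_def)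
  define d where "d = min 1 (e / c)"
  have d: "0 < d" "d \<le> 1" "c * d \<le> e"
    using e c by (auto simp: d_def min_def field_simps)
  show "\<exists>d>0. \<forall>\<phi>\<in>D. \<forall>v\<in>V. ?M (\<phi> - \<phi>0) < d \<and> N (v - v0) < d \<longrightarrow> \<bar>\<phi> v - \<phi>0 v0\<bar> < e"
  proof (intro exI[of _ d] conjI ballI impI d(1), elim conjE)
    fix \<phi> v
    assume \<phi>: "\<phi> \<in> D" and v: "v \<in> V" and close: "?M (\<phi> - \<phi>0) < d" "N (v - v0) < d"
    have diffs: "\<phi> - \<phi>0 \<in> dual_on V N" "v - v0 \<in> V" "\<phi>0 \<in> dual_on V N"
      using \<phi> \<phi>0 v v0 assms carrier by (auto intro: subspace_diff subspace_dual)
    have "N v < N v0 + 1"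
      using triangle[OF diffs(2) v0] close(2) d(2) by simp
    then have "?M (\<phi> - \<phi>0) * N v \<le> ?M (\<phi> - \<phi>0) * (N v0 + 1)"
      using dual_norm_nonneg[OF diffs(1)] by (simp add: mult_left_mono)
    also have "\<dots> < d * (N v0 + 1)"
      using close(1) nonneg[OF v0] by (simp add: mult_strict_right_mono)
    finally have 1: "\<bar>(\<phi> - \<phi>0) v\<bar> < d * (N v0 + 1)"
      using dual_norm_bound[OF diffs(1) v] by linarith
    have 2: "\<bar>\<phi>0 (v - v0)\<bar> \<le> ?M \<phi>0 * d"
      using dual_norm_bound[OF diffs(3,2)] close(2) dual_norm_nonneg[OF diffs(3)]
      by (meson less_imp_le mult_left_mono order_trans)
    have "\<phi> v - \<phi>0 v0 = (\<phi> - \<phi>0) v + \<phi>0 (v - v0)"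
      using functional_diff[OF dual_linear[OF diffs(3)] v v0] by simp
    then have "\<bar>\<phi> v - \<phi>0 v0\<bar> < d * (N v0 + 1) + ?M \<phi>0 * d"
      using 1 2 by linarith
    also have "\<dots> = c * d" by (simp add: c_def algebra_simps)
    finally show "\<bar>\<phi> v - \<phi>0 v0\<bar> < e" using d(3) by linarith
  qed
qed

end

section \<open>The twin operators of the kernel\<close>

lemma adj_kernel_apply:
  "adj_kernel x (f, v') u' u = blinfun_apply u' (f x) * blinfun_apply v' u"
  by (simp add: adj_kernel_def)

text \<open>The operator on the primal side is unique because, by Hahn-Banach, functionals separate
  points.\<close>

lemma twin_op_eqI:
  assumes "linear TU" "\<And>d u. blinfun_apply d (TU u) = T d u"
  shows "twin_op blinfun_apply T = TU"
  unfolding twin_op_def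
proof (rule the_equality)
  fix S
  assume "linear S \<and> (\<forall>d u. blinfun_apply d (S u) = T d u)"
  then have "blinfun_apply d (S u) = blinfun_apply d (TU u)" for d :: "_ \<Rightarrow>\<^sub>L real" and u
    using assms(2) by simp
  then show "S = TU" by (intro ext) (rule blinfun_separates_points)
qed (use assms in simp)

text \<open>Here uniqueness is mere extensionality of functionals, in contrast to
  \<open>twin_op_eqI\<close>.\<close>

lemma twin_op_dual_eqI:
  assumes "linear TD" "\<And>d u. T d u = blinfun_apply (TD d) u"
  shows "twin_op_dual blinfun_apply T = TD"
  unfolding twin_op_dual_def
proof (rule the_equality)
  fix S
  assume "linear S \<and> (\<forall>d u. T d u = blinfun_apply (S d) u)"
  then show "S = TD" using assms(2) by (intro ext blinfun_eqI) simp
qed (use assms in simp)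

lemma twin_op_adj_kernel:
  "twin_op blinfun_apply (adj_kernel x (f, v')) = (\<lambda>u. blinfun_apply v' u *\<^sub>R f x)"
  by (rule twin_op_eqI)
    (auto intro!: linearI simp: adj_kernel_def blinfun.add_right blinfun.scaleR_right scaleR_add_left)

lemma twin_op_dual_adj_kernel:
  "twin_op_dual blinfun_apply (adj_kernel x (f, v')) = (\<lambda>u'. blinfun_apply u' (f x) *\<^sub>R v')"
  by (rule twin_op_dual_eqI)
    (auto intro!: linearI simp: adj_kernel_def blinfun.add_left blinfun.scaleR_left scaleR_add_left)

lemma adj_kernel_in_Twin: "adj_kernel x (f, v') \<in> Twin blinfun_apply"
proof -
  \<comment> \<open>The kernel value is a product of two bounded functionals: evaluation of
    \<open>u'\<close> at \<open>f x\<close>, and \<open>v'\<close>.\<close>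
  have "bounded_bilinear (\<lambda>u' u. blinfun_apply u' (f x) * blinfun_apply v' u)"
    by (rule bounded_bilinear.comp[OF bounded_bilinear_mult])
      (intro bounded_linear_intros)+
  moreover have "linear (\<lambda>u. blinfun_apply v' u *\<^sub>R f x)"
    by (auto intro!: linearI simp: blinfun.add_right blinfun.scaleR_right scaleR_add_left)
  moreover have "linear (\<lambda>u'. blinfun_apply u' (f x) *\<^sub>R v')"
    by (auto intro!: linearI simp: blinfun.add_left blinfun.scaleR_left scaleR_add_left)
  ultimately show ?thesis
    unfolding Twin_def adj_kernel_def
    by (auto simp: blinfun.scaleR_right blinfun.scaleR_left
        intro!: exI[of _ "\<lambda>u. blinfun_apply v' u *\<^sub>R f x"] exI[of _ "\<lambda>u'. blinfun_apply u' (f x) *\<^sub>R v'"])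
qed

text \<open>Nondegeneracy in the vector is Hahn-Banach; in the functional it is
  extensionality.\<close>

lemma dual_pair_blinfun:
  "dual_pair (UNIV :: 'u::banach set) norm (UNIV :: ('u \<Rightarrow>\<^sub>L real) set) norm blinfun_apply"
  unfolding dual_pair_def
proof (intro conjI)
  show "\<forall>f\<in>UNIV. (\<forall>g\<in>UNIV. blinfun_apply g f = (0 :: real)) \<longrightarrow> f = (0 :: 'u)"
    by (intro ballI impI, rule blinfun_separates_points) (simp add: blinfun.zero_right)
  show "\<forall>g\<in>UNIV. (\<forall>f\<in>UNIV. blinfun_apply g (f :: 'u) = 0) \<longrightarrow> g = (0 :: 'u \<Rightarrow>\<^sub>L real)"
    by (auto intro!: blinfun_eqI)
qed (auto simp: banach_on_UNIV bilinear_on_def linear_functional_on_def blinfun.add_left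
    blinfun.add_right blinfun.scaleR_left blinfun.scaleR_right)

section \<open>The adjoint space\<close>

lemma scaleR_fun_apply: "(c *\<^sub>R f) x = c *\<^sub>R f x"
  by (simp add: scaleR_fun_def)

lemma linear_adj_fun: "linear (adj_fun B)"
  by (auto intro!: linearI ext simp: adj_fun_def zero_ext_def scaleR_fun_def scaleR_add_left)

lemma adj_fun_apply: "f \<in> B \<Longrightarrow> adj_fun B \<phi> (f, v') = \<phi> f *\<^sub>R v'"
  by (simp add: adj_fun_def zero_ext_def adj_dom_def)

lemma point_eval_apply: "f \<in> B \<Longrightarrow> point_eval B x u' f = blinfun_apply u' (f x)"
  by (simp add: point_eval_def zero_ext_def)

locale vv_RKBS_space =
  fixes X :: "'x set" and B :: "('x \<Rightarrow> 'u::banach) set" and N :: "('x \<Rightarrow> 'u) \<Rightarrow> real"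
  assumes vv_RKBS: "vv_RKBS X B N"

sublocale vv_RKBS_space \<subseteq> normed_on B N
  by (rule banach_on_imp_normed_on, rule vv_RKBS[unfolded vv_RKBS_def, THEN conjunct1])

context vv_RKBS_space
begin

section \<open>The evaluations and their closed span\<close>

lemmas vv_RKBS_unfolded = vv_RKBS[unfolded vv_RKBS_def]

lemma banach: "banach_on B N"
  by (rule vv_RKBS_unfolded[THEN conjunct1])

lemma vanishes_outside: "f \<in> B \<Longrightarrow> x \<notin> X \<Longrightarrow> f x = 0"
  by (rule vv_RKBS_unfolded[THEN conjunct2, THEN conjunct1, rule_format])

lemma bounded_evaluation: "x \<in> X \<Longrightarrow> \<exists>C\<ge>0. \<forall>f\<in>B. norm (f x) \<le> C * N f"
  by (rule vv_RKBS_unfolded[THEN conjunct2, THEN conjunct2, rule_format])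

lemma point_eval_in_dual:
  assumes "x \<in> X"
  shows "point_eval B x u' \<in> dual_on B N"
proof -
  obtain C where C: "\<And>f. f \<in> B \<Longrightarrow> norm (f x) \<le> C * N f"
    using bounded_evaluation[OF assms] by blast
  show ?thesis
  proof (rule dual_onI[where C = "norm u' * C"])
    show "linear_functional_on B (point_eval B x u')"
      using carrier
      by (simp add: linear_functional_on_def point_eval_def zero_ext_def subspace_add
          subspace_scale scaleR_fun_apply blinfun.add_right blinfun.scaleR_right)
    fix f
    assume f: "f \<in> B"
    have "\<bar>u' (f x)\<bar> \<le> norm u' * norm (f x)"
      using norm_blinfun[of u' "f x"] by simp
    also have "\<dots> \<le> norm u' * (C * N f)"
      using C[OF f] by (simp add: mult_left_mono)
    finally show "\<bar>point_eval B x u' f\<bar> \<le> norm u' * C * N f"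
      using f by (simp add: point_eval_def zero_ext_def mult.assoc)
  qed (simp add: point_eval_def zero_ext_def)
qed

lemma eval_span_subset_dual: "eval_span X B \<subseteq> dual_on B N"
  unfolding eval_span_def using point_eval_in_dual subspace_dual by (intro span_minimal) auto

text \<open>The set is the closure of a span inside the complete dual, so
  \<open>banach_on_closure\<close> applies.\<close>

lemma banach_on_eval_closure: "banach_on (eval_closure X B N) (dual_norm_on B N)"
  using banach_on_closure[OF banach_on_dual _ eval_span_subset_dual]
  by (simp add: eval_closure_def dual_closure_on_def eval_span_def)

lemma dense_on_eval_span: "dense_on (eval_closure X B N) (dual_norm_on B N) (eval_span X B)"
  using dense_on_closure[OF banach_on_dual _ eval_span_subset_dual]
  by (simp add: eval_closure_def dual_closure_on_def eval_span_def)

lemma eval_closure_subset_dual: "eval_closure X B N \<subseteq> dual_on B N"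
  by (auto simp: eval_closure_def dual_closure_on_def)

lemma point_eval_in_eval_closure: "x \<in> X \<Longrightarrow> point_eval B x u' \<in> eval_closure X B N"
  using dense_on_eval_span by (auto simp: dense_on_def eval_span_def intro: span_base)

lemma inj_on_adj_fun: "inj_on (adj_fun B) (dual_on B N)"
proof (rule inj_onI)
  fix \<phi> \<psi>
  assume *: "\<phi> \<in> dual_on B N" "\<psi> \<in> dual_on B N" and eq: "adj_fun B \<phi> = adj_fun B \<psi>"
  show "\<phi> = \<psi>"
  proof
    fix f
    \<comment> \<open>Off \<open>B\<close> and at 0 both functionals vanish. Otherwise some value
      \<open>f x\<close> is nonzero, so a nonzero \<open>v'\<close> exists, and the value at
      \<open>(f, v')\<close> determines the functional at \<open>f\<close>.\<close>
    consider "f \<notin> B" | "f = 0" | x where "f \<in> B" "f x \<noteq> 0" by (auto simp: fun_eq_iff)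
    then show "\<phi> f = \<psi> f"
    proof cases
      case (3 x)
      obtain v' :: "'u \<Rightarrow>\<^sub>L real" where "v' (f x) = norm (f x)" by (rule exists_norming_blinfun)
      then have "v' \<noteq> 0" using 3 by auto
      moreover have "\<phi> f *\<^sub>R v' = \<psi> f *\<^sub>R v'"
        using adj_fun_apply[OF 3(1)] eq by metis
      ultimately show ?thesis by simp
    qed (use * in \<open>simp_all add: dual_outside dual_zero\<close>)
  qed
qed

text \<open>Justifies the definite description in \<open>adj_star\<close>.\<close>

lemma ex1_adj_star:
  assumes "g \<in> adj_space X B N"
  shows "\<exists>!\<phi>. \<phi> \<in> eval_closure X B N \<and> g = adj_fun B \<phi>"
  using assms inj_onD[OF inj_on_adj_fun] eval_closure_subset_dual
  unfolding adj_space_def by blast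

section \<open>The isometry \<open>adj_fun\<close> and the structure it transports\<close>

lemma adj_space_eq: "adj_space X B N = adj_fun B ` eval_closure X B N"
  by (auto simp: adj_space_def)

lemma adj_star_adj_fun: "\<phi> \<in> eval_closure X B N \<Longrightarrow> adj_star X B N (adj_fun B \<phi>) = \<phi>"
  unfolding adj_star_def using inj_onD[OF inj_on_adj_fun] eval_closure_subset_dual
  by (intro the_equality) blast+

lemma adj_norm_adj_fun:
  "\<phi> \<in> eval_closure X B N \<Longrightarrow> adj_norm X B N (adj_fun B \<phi>) = dual_norm_on B N \<phi>"
  by (simp add: adj_norm_def adj_star_adj_fun)

lemma adj_pairing_adj_fun:
  "\<phi> \<in> eval_closure X B N \<Longrightarrow> adj_pairing X B N (adj_fun B \<phi>) f = \<phi> f"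
  by (simp add: adj_pairing_def adj_star_adj_fun)

lemma subspace_eval_closure: "subspace (eval_closure X B N)"
  using banach_on_eval_closure by (simp add: banach_on_def)

lemma adj_norm_diff:
  "\<phi> \<in> eval_closure X B N \<Longrightarrow> \<psi> \<in> eval_closure X B N \<Longrightarrow>
    adj_norm X B N (adj_fun B \<phi> - adj_fun B \<psi>) = dual_norm_on B N (\<phi> - \<psi>)"
  using adj_norm_adj_fun[of "\<phi> - \<psi>"] subspace_eval_closure
  by (simp add: linear_diff[OF linear_adj_fun] subspace_diff)

lemma banach_on_adj_space: "banach_on (adj_space X B N) (adj_norm X B N)"
  unfolding adj_space_eq
  by (rule banach_on_linear_image)
    (rule banach_on_eval_closure linear_adj_fun adj_norm_adj_fun, assumption?)+

text \<open>The operator norm estimate for the functional at \<open>f\<close> gives the evaluation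
  constant \<open>N f * norm v'\<close> at \<open>(f, v')\<close>.\<close>

lemma vv_RKBS_adj_space: "vv_RKBS (adj_dom B) (adj_space X B N) (adj_norm X B N)"
  unfolding vv_RKBS_def
proof (intro conjI ballI allI impI)
  fix g w
  assume "g \<in> adj_space X B N" "w \<notin> adj_dom B"
  then show "g w = 0" by (auto simp: adj_space_eq adj_fun_def zero_ext_def)
next
  fix w
  assume "w \<in> adj_dom B"
  then obtain f v' where w: "w = (f, v')" "f \<in> B" by (auto simp: adj_dom_def)
  have "norm (g w) \<le> N f * norm v' * adj_norm X B N g" if g: "g \<in> adj_space X B N" for g
  proof -
    obtain \<phi> where \<phi>: "\<phi> \<in> eval_closure X B N" "g = adj_fun B \<phi>"
      using g by (auto simp: adj_space_eq)
    have "norm (g w) = \<bar>\<phi> f\<bar> * norm v'" using w \<phi> by (simp add: adj_fun_apply)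
    also have "\<dots> \<le> dual_norm_on B N \<phi> * N f * norm v'"
      using dual_norm_bound w(2) \<phi>(1) eval_closure_subset_dual by (intro mult_right_mono) auto
    finally show ?thesis using \<phi> by (simp add: adj_norm_adj_fun mult_ac)
  qed
  then show "\<exists>C\<ge>0. \<forall>g\<in>adj_space X B N. norm (g w) \<le> C * adj_norm X B N g"
    using nonneg[OF w(2)] by (intro exI[of _ "N f * norm v'"]) simp
qed (rule banach_on_adj_space)

text \<open>On \<open>X\<close> the values vanish by Hahn-Banach in the value space; off
  \<open>X\<close> functions in \<open>B\<close> are zero by the encoding.\<close>

lemma point_eval_separates:
  assumes f: "f \<in> B" and "\<And>x u'. x \<in> X \<Longrightarrow> point_eval B x u' f = 0"
  shows "f = 0"
proof
  fix x
  have "f x = 0" if "x \<in> X"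
  proof (rule blinfun_separates_points)
    show "blinfun_apply u' (f x) = blinfun_apply u' 0" for u' :: "'u \<Rightarrow>\<^sub>L real"
      using assms(2)[OF that] f by (simp add: point_eval_def zero_ext_def blinfun.zero_right)
  qed
  then show "f x = 0 x" using vanishes_outside[OF f] by auto
qed

lemma dual_pair_adj_space:
  "dual_pair B N (adj_space X B N) (adj_norm X B N) (adj_pairing X B N)"
  unfolding dual_pair_def
proof (intro conjI ballI impI)
  have "linear_functional_on (adj_space X B N) (\<lambda>g. adj_pairing X B N g f)" for f
    using subspace_eval_closure
    by (auto simp: linear_functional_on_def adj_space_eq adj_pairing_adj_fun subspace_add
        subspace_scale scaleR_fun_apply linear_add[OF linear_adj_fun, symmetric]
        linear_scale[OF linear_adj_fun, symmetric])
  moreover have "linear_functional_on B (\<lambda>f. adj_pairing X B N g f)"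
    if "g \<in> adj_space X B N" for g
    using that dual_linear eval_closure_subset_dual
    by (auto simp: adj_space_eq adj_pairing_adj_fun)
  ultimately show "bilinear_on B (adj_space X B N) (adj_pairing X B N)"
    by (simp add: bilinear_on_def)
next
  fix f
  assume "f \<in> B" "\<forall>g\<in>adj_space X B N. adj_pairing X B N g f = 0"
  then show "f = 0"
    by (intro point_eval_separates)
      (auto simp: adj_space_eq adj_pairing_adj_fun point_eval_in_eval_closure)
next
  fix g
  assume "g \<in> adj_space X B N" and g: "\<forall>f\<in>B. adj_pairing X B N g f = 0"
  then obtain \<phi> where \<phi>: "\<phi> \<in> eval_closure X B N" "g = adj_fun B \<phi>"
    by (auto simp: adj_space_eq)
  \<comment> \<open>Elements of the dual vanish off \<open>B\<close>, so vanishing on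
    \<open>B\<close> makes the total function zero.\<close>
  then have "\<phi> f = 0" for f
    using g dual_outside eval_closure_subset_dual by (cases "f \<in> B") (auto simp: adj_pairing_adj_fun)
  then have "\<phi> = 0" by auto
  then show "g = 0" using \<phi>(2) linear_0[OF linear_adj_fun] by simp
qed (rule banach banach_on_adj_space)+

lemma continuous_pairing_adj_space:
  "continuous_pairing B N (adj_space X B N) (adj_norm X B N) (adj_pairing X B N)"
  using continuous_pairing_dual[OF eval_closure_subset_dual]
  unfolding continuous_pairing_def
  by (simp add: adj_space_eq adj_norm_diff adj_pairing_adj_fun)

section \<open>Kernel sections, reproducing identities and density\<close>

lemma kernel_fun_adj_kernel:
  assumes "f \<in> B"
  shows "kernel_fun X blinfun_apply adj_kernel (f, v') u = blinfun_apply v' u *\<^sub>R f"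
  \<comment> \<open>As \<open>f\<close> is zero off \<open>X\<close> already,
    \<open>zero_ext\<close> changes nothing.\<close>
  using vanishes_outside[OF assms]
  by (auto simp: kernel_fun_def zero_ext_def twin_op_adj_kernel scaleR_fun_def)

text \<open>This identity turns statements about kernel sections into statements about
  evaluations.\<close>

lemma kernel_fun_dual_adj_kernel:
  "kernel_fun_dual (adj_dom B) blinfun_apply adj_kernel x u' = adj_fun B (point_eval B x u')"
  by (auto simp: kernel_fun_dual_def adj_fun_def zero_ext_def twin_op_dual_adj_kernel
      point_eval_def adj_dom_def)

lemma adjoint_pair_adj_space:
  "adjoint_pair_vv_RKBS X B N (adj_dom B) (adj_space X B N) (adj_norm X B N)
     blinfun_apply (adj_pairing X B N) adj_kernel"
  unfolding adjoint_pair_vv_RKBS_def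
proof (intro conjI ballI allI)
  fix x w
  show "adj_kernel x w \<in> Twin blinfun_apply"
    by (cases w) (simp add: adj_kernel_in_Twin)
next
  fix x u'
  let ?k = "kernel_fun_dual (adj_dom B) blinfun_apply adj_kernel x u'"
  assume "x \<in> X"
  then have mem: "point_eval B x u' \<in> eval_closure X B N" by (rule point_eval_in_eval_closure)
  then show "?k \<in> adj_space X B N"
    by (simp add: kernel_fun_dual_adj_kernel adj_space_eq)
  fix f
  assume "f \<in> B"
  then show "blinfun_apply u' (f x) = adj_pairing X B N ?k f"
    using mem
    by (simp add: kernel_fun_dual_adj_kernel adj_pairing_adj_fun point_eval_def zero_ext_def)
next
  fix w and u :: 'u
  let ?k = "kernel_fun X blinfun_apply adj_kernel w u"
  assume "w \<in> adj_dom B"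
  then obtain f v' where w: "w = (f, v')" "f \<in> B" by (auto simp: adj_dom_def)
  then show "?k \<in> B"
    using carrier by (simp add: kernel_fun_adj_kernel subspace_scale)
  fix g
  assume "g \<in> adj_space X B N"
  then obtain \<phi> where \<phi>: "\<phi> \<in> eval_closure X B N" "g = adj_fun B \<phi>"
    by (auto simp: adj_space_eq)
  then have "linear_functional_on B \<phi>"
    using dual_linear eval_closure_subset_dual by blast
  \<comment> \<open>Both sides are \<open>\<phi> f\<close> times \<open>v' u\<close>; on the right
    the scalar \<open>v' u\<close> is pulled out of the functional.\<close>
  then show "blinfun_apply (g w) u = adj_pairing X B N g ?k"
    using w \<phi> by (simp add: adj_fun_apply kernel_fun_adj_kernel adj_pairing_adj_fun
        linear_functional_on_scaled_arg blinfun.scaleR_left)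
qed (rule dual_pair_blinfun vv_RKBS vv_RKBS_adj_space dual_pair_adj_space
    continuous_pairing_adj_space)+

lemma adj_star_norm_unit_ball:
  assumes "g \<in> adj_space X B N"
  shows "dual_norm_on B N (adj_star X B N g) = (SUP f\<in>{f\<in>B. N f \<le> 1}. \<bar>adj_star X B N g f\<bar>)"
proof (rule dual_norm_unit_ball)
  show "adj_star X B N g \<in> dual_on B N"
    using assms eval_closure_subset_dual by (auto simp: adj_space_eq adj_star_adj_fun)
qed

text \<open>A linear map commutes with spans and \<open>adj_fun\<close> is isometric, so density of
  the evaluations in their closure carries over.\<close>

lemma dense_on_kernel_span:
  "dense_on (adj_space X B N) (adj_norm X B N)
     (span {kernel_fun_dual (adj_dom B) blinfun_apply adj_kernel x u' | x u'. x \<in> X})"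
proof -
  have "{kernel_fun_dual (adj_dom B) blinfun_apply adj_kernel x u' | x u'. x \<in> X}
      = adj_fun B ` {point_eval B x u' | x u'. x \<in> X}"
    by (auto simp: kernel_fun_dual_adj_kernel)
  then have "span {kernel_fun_dual (adj_dom B) blinfun_apply adj_kernel x u' | x u'. x \<in> X}
      = adj_fun B ` eval_span X B"
    by (simp add: linear_span_image[OF linear_adj_fun] eval_span_def)
  moreover have "dense_on (adj_space X B N) (adj_norm X B N) (adj_fun B ` eval_span X B)"
    using dense_on_eval_span unfolding dense_on_def adj_space_eq
    by (auto simp: adj_norm_diff subset_iff)
  ultimately show ?thesis by simp
qed

end

theorem theorem3p4:
  fixes X :: "'x set"
    and B :: "('x \<Rightarrow> 'u::banach) set"
    and N :: "('x \<Rightarrow> 'u) \<Rightarrow> real"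
  assumes "vv_RKBS X B N"
  shows "(\<forall>g\<in>adj_space X B N. \<exists>!\<phi>. \<phi> \<in> eval_closure X B N \<and> g = adj_fun B \<phi>) \<and>
    (adjoint_pair_vv_RKBS X B N (adj_dom B) (adj_space X B N) (adj_norm X B N)
           blinfun_apply (adj_pairing X B N) adj_kernel) \<and>
    (\<forall>x\<in>X. \<forall>f\<in>B. \<forall>v' u.
           twin_op blinfun_apply (adj_kernel x (f, v')) u = blinfun_apply v' u *\<^sub>R f x) \<and>
    (\<forall>x\<in>X. \<forall>f\<in>B. \<forall>v' u'.
           twin_op_dual blinfun_apply (adj_kernel x (f, v')) u' = blinfun_apply u' (f x) *\<^sub>R v') \<and>
    (\<forall>x\<in>X. \<forall>f\<in>B. \<forall>v' u' u.
           adj_kernel x (f, v') u' u = blinfun_apply u' (f x) * blinfun_apply v' u \<and>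
           adj_kernel x (f, v') u' u = point_eval B x u' f * blinfun_apply v' u) \<and>
    (\<forall>g\<in>adj_space X B N.
           adj_norm X B N g = dual_norm_on B N (adj_star X B N g) \<and>
           dual_norm_on B N (adj_star X B N g) =
             (SUP f\<in>{f\<in>B. N f \<le> 1}. \<bar>adj_star X B N g f\<bar>) \<and>
           (SUP f\<in>{f\<in>B. N f \<le> 1}. \<bar>adj_star X B N g f\<bar>) =
             (SUP f\<in>{f\<in>B. N f \<le> 1}. \<bar>adj_pairing X B N g f\<bar>)) \<and>
    (\<forall>x\<in>X. \<forall>u'. kernel_fun_dual (adj_dom B) blinfun_apply adj_kernel x u' =
           zero_ext (adj_dom B) (\<lambda>(f, v'). point_eval B x u' f *\<^sub>R v')) \<and>
    (dense_on (adj_space X B N) (adj_norm X B N)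
           (span {kernel_fun_dual (adj_dom B) blinfun_apply adj_kernel x u' | x u'. x \<in> X}))"
proof -
  interpret vv_RKBS_space X B N using assms by unfold_locales
  have "kernel_fun_dual (adj_dom B) blinfun_apply adj_kernel x u' =
      zero_ext (adj_dom B) (\<lambda>(f, v'). point_eval B x u' f *\<^sub>R v')" for x u'
    by (simp add: kernel_fun_dual_adj_kernel adj_fun_def)
  moreover have "dual_norm_on B N (adj_star X B N g) =
      (SUP f\<in>{f\<in>B. N f \<le> 1}. \<bar>adj_star X B N g f\<bar>)" if "g \<in> adj_space X B N" for g
    using that by (rule adj_star_norm_unit_ball)
  ultimately show ?thesis
    by (intro conjI ballI allI ex1_adj_star adjoint_pair_adj_space dense_on_kernel_span)
      (simp_all add: twin_op_adj_kernel twin_op_dual_adj_kernel adj_norm_def adj_pairing_def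
        adj_kernel_apply point_eval_apply)
qed

end
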